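(* Let $i,j\in\mathbb{N}$. Then the following formula holds in $\mathcal{R}_q^{+}$: $$\genfrac{[}{]}{0pt}{}{x}{i}\genfrac{[}{]}{0pt}{}{x}{j}=\sum_{k=\max(i,j)}^{i+j}\frac{q^{(k-i)(k-j)}\,[k]_q!}{[k-i]_q!\,[k-j]_q!\,[i+j-k]_q!}\genfrac{[}{]}{0pt}{}{x}{k}.$$ In particular, the $\mathbb{Z}[q]$-algebra $\mathcal{R}_q^{+}$ with distinguished basis $\left\{\genfrac{[}{]}{0pt}{}{x}{k} : k\in\mathbb{N}\right\}$ has structure constants in $\mathbb{N}[q]$.
   Context: Here $q$ and $x$ are commuting indeterminates, $\mathbb{N}=\{0,1,2,\dots\}$. For $n\in\mathbb{N}$, $[n]_q:=(q^n-1)/(q-1)=1+q+\cdots+q^{n-1}$ and $[n]_q!:=[n]_q[n-1]_q\cdots[1]_q$ with $[0]_q!:=1$. $\mathcal{R}_q^{+}:=\{P(x)\in\mathbb{Q}(q)[x] : P([n]_q)\in\mathbb{Z}[q]\text{ for all }n\in\mathbb{N}\}$. The $q$-binomial coefficient polynomials are $\genfrac{[}{]}{0pt}{}{x}{k}:=\frac{x(x-[1]_q)\cdots(x-[k-1]_q)}{q^{\binom{k}{2}}[k]_q!}$ for $k\ge1$ and $\genfrac{[}{]}{0pt}{}{x}{0}:=1$; they form a $\mathbb{Z}[q]$-module basis of $\mathcal{R}_q^{+}$. $\mathbb{N}[q]$ denotes polynomials in $q$ with coefficients in $\mathbb{N}$. *)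

theory Defs
  imports "HOL-Computational_Algebra.Computational_Algebra"
begin

text \<open>
  The field of rational functions in \<open>q\<close> is the fraction field of the polynomial ring over the
  rationals; polynomials in the second indeterminate \<open>x\<close> have coefficients in that field.
\<close>
type_synonym ratfun = "rat poly fract"

definition q :: ratfun where
  "q = to_fract [:0, 1:]"

definition q_int :: "nat \<Rightarrow> ratfun" where
  "q_int n = (q ^ n - 1) / (q - 1)"

definition q_fact :: "nat \<Rightarrow> ratfun" where
  "q_fact n = (\<Prod>m=1..n. q_int m)"

text \<open>The type \<^typ>\<open>int poly\<close> plays the role of the ring of integer polynomials in \<open>q\<close>;
  this is its embedding into the rational functions.\<close>
definition emb :: "int poly \<Rightarrow> ratfun" where
  "emb p = to_fract (map_poly of_int p)"

definition Zq :: "ratfun set" where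
  "Zq = range emb"

definition Nq :: "int poly set" where
  "Nq = {p. \<forall>n. coeff p n \<ge> 0}"

definition Rq_plus :: "ratfun poly set" where
  "Rq_plus = {P. \<forall>n. poly P (q_int n) \<in> Zq}"

text \<open>The factor for \<open>m = 0\<close> is \<open>x\<close> itself, since \<^prop>\<open>q_int 0 = 0\<close>.\<close>
definition q_binom :: "nat \<Rightarrow> ratfun poly" where
  "q_binom k = smult (1 / (q ^ (k choose 2) * q_fact k)) (\<Prod>m<k. [:- q_int m, 1:])"

definition Zq_scale :: "int poly \<Rightarrow> ratfun poly \<Rightarrow> ratfun poly" where
  "Zq_scale p P = smult (emb p) P"

lemma emb_add: "emb (a + b) = emb a + emb b"
proof -
  have "map_poly (of_int :: int \<Rightarrow> rat) (a + b) = map_poly of_int a + map_poly of_int b"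
    by (rule poly_eqI) (simp add: coeff_map_poly)
  then show ?thesis by (simp add: emb_def)
qed

lemma emb_mult: "emb (a * b) = emb a * emb b"
proof -
  have "map_poly (of_int :: int \<Rightarrow> rat) (a * b) = map_poly of_int a * map_poly of_int b"
    by (rule poly_eqI) (simp add: coeff_map_poly coeff_mult)
  then show ?thesis by (simp add: emb_def)
qed

lemma emb_1: "emb 1 = 1"
  by (simp add: emb_def)

interpretation Zq: module Zq_scale
  by unfold_locales
    (simp_all add: Zq_scale_def emb_add emb_mult emb_1 smult_add_left smult_add_right)

definition Zq_subalgebra :: "ratfun poly set \<Rightarrow> bool" where
  "Zq_subalgebra A \<longleftrightarrow>
     Zq.subspace A \<and> 1 \<in> A \<and> (\<forall>P\<in>A. \<forall>Q\<in>A. P * Q \<in> A)"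

definition Zq_basis :: "ratfun poly set \<Rightarrow> ratfun poly set \<Rightarrow> bool" where
  "Zq_basis B A \<longleftrightarrow> Zq.independent B \<and> Zq.span B = A"

text \<open>For a basis \<open>B\<close>, the coefficient of the basis element \<open>c\<close> in the product of the basis
  elements \<open>a\<close> and \<open>b\<close>; only meaningful when \<open>B\<close> is independent and spans \<open>a * b\<close>,
  because \<^const>\<open>Zq.representation\<close> is zero otherwise.\<close>
definition structure_constant ::
    "ratfun poly set \<Rightarrow> ratfun poly \<Rightarrow> ratfun poly \<Rightarrow> ratfun poly \<Rightarrow> int poly" where
  "structure_constant B a b c = Zq.representation B (a * b) c"

end

theory Submission
  imports Defs
begin

text \<open>
  Write \<open>B\<^sub>k\<close> for the q-binomial polynomial of degree \<open>k\<close>. Two facts carry everything.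

  First, \<open>B\<^sub>k\<close> takes the value \<open>[n]\<^sub>q! / ([n - k]\<^sub>q! [k]\<^sub>q!)\<close> at \<open>[n]\<^sub>q\<close> (zero if \<open>n < k\<close>). By the
  q-Pascal rule these Gaussian binomials are polynomials in \<open>q\<close> with natural coefficients
  (\<open>gaussian_binomial_Nq\<close>), so \<open>B\<^sub>k\<close> lies in the algebra. The matrix of values
  is unitriangular: evaluating a vanishing combination at \<open>[k]\<^sub>q\<close> for the smallest index \<open>k\<close> that
  occurs isolates the coefficient of \<open>B\<^sub>k\<close>, which gives independence; choosing coefficients one
  after the other interpolates any member of the algebra at \<open>[0]\<^sub>q, \<dots>, [N]\<^sub>q\<close> with coefficients
  that are integer polynomials in \<open>q\<close>, and with \<open>N\<close> equal to its degree the interpolant is that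
  member itself (\<open>newton_interpolation\<close>, \<open>span_q_binom\<close>).

  Second, the definition of \<open>B\<^sub>k\<close> gives \<open>(x - [k]\<^sub>q) B\<^sub>k = q\<^bsup>k\<^esup> [k + 1]\<^sub>q B\<^bsub>k + 1\<^esub>\<close> (\<open>q_binom_Suc\<close>).
  Multiplying \<open>B\<^sub>i B\<^sub>j\<close> by \<open>x - [i]\<^sub>q\<close> therefore raises \<open>i\<close> on the left, while on the right
  \<open>x - [i]\<^sub>q = (x - [k]\<^sub>q) + ([k]\<^sub>q - [i]\<^sub>q)\<close> turns each \<open>B\<^sub>k\<close> into a combination of \<open>B\<^sub>k\<close> and
  \<open>B\<^bsub>k + 1\<^esub>\<close>. The product formula follows by induction on \<open>i\<close> once its coefficients are seen to
  satisfy the resulting recurrence (\<open>q_binom_coeff_rec\<close>), which comes down to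
  \<open>[m + n]\<^sub>q = [m]\<^sub>q + q\<^bsup>m\<^esup> [n]\<^sub>q\<close>. Each coefficient is a power of \<open>q\<close> times a q-trinomial coefficient,
  hence a product of Gaussian binomials, so it has natural coefficients.
\<close>

section \<open>Arithmetic of q-integers and q-factorials\<close>

text \<open>
  As \<open>q\<close> is an indeterminate and not a root of unity, the q-integers of positive index are
  nonzero and may be divided by.
\<close>
lemma q_power_neq_1:
  assumes "n > 0"
  shows "q ^ n \<noteq> 1"
proof
  have "q ^ n = to_fract (monom 1 n)"
    by (induction n) (simp_all add: q_def monom_Suc flip: to_fract_mult)
  moreover assume "q ^ n = 1"
  ultimately have "to_fract (monom 1 n :: rat poly) = to_fract 1"
    by simp
  then have "degree (monom 1 n :: rat poly) = degree (1 :: rat poly)"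
    by (simp only: to_fract_eq_iff)
  then show False
    using assms by (simp add: degree_monom_eq)
qed

lemma q_neq_0 [simp]: "q \<noteq> 0"
  by (simp add: q_def)

lemma q_int_0 [simp]: "q_int 0 = 0"
  by (simp add: q_int_def)

lemma q_int_neq_0 [simp]: "q_int (Suc n) \<noteq> 0"
  using q_power_neq_1[of 1] q_power_neq_1[of "Suc n"] by (simp add: q_int_def del: power_Suc)

lemma q_int_add: "q_int (m + n) = q_int m + q ^ m * q_int n"
proof -
  have "q ^ (m + n) - 1 = (q ^ m - 1) + q ^ m * (q ^ n - 1)"
    by (simp add: power_add algebra_simps)
  then show ?thesis
    by (simp only: q_int_def add_divide_distrib times_divide_eq_right)
qed

lemma inj_q_int: "inj q_int"
proof -
  have "q_int m \<noteq> q_int n" if "m < n" for m n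
    using that q_int_add[of m "Suc (n - Suc m)"] by simp
  then show ?thesis
    by (metis injI linorder_neqE_nat)
qed

lemma q_fact_0 [simp]: "q_fact 0 = 1"
  by (simp add: q_fact_def)

lemma q_fact_Suc: "q_fact (Suc n) = q_int (Suc n) * q_fact n"
  by (simp add: q_fact_def mult.commute)

lemma q_fact_neq_0 [simp]: "q_fact n \<noteq> 0"
  by (induction n) (simp_all add: q_fact_Suc)


section \<open>Polynomials in q inside the rational functions\<close>

lemma inj_emb: "inj emb"
  by (rule injI) (auto simp: emb_def poly_eq_iff coeff_map_poly)

lemma emb_0 [simp]: "emb 0 = 0"
  by (simp add: emb_def)

lemma emb_eq_0_iff [simp]: "emb p = 0 \<longleftrightarrow> p = 0"
  using inj_emb emb_0 by (metis injD)

lemma emb_var: "emb [:0, 1:] = q"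
  by (simp add: emb_def q_def map_poly_pCons)

lemma emb_monom: "emb (monom 1 n) = q ^ n"
proof (induction n)
  case 0
  then show ?case by (simp add: emb_1)
next
  case (Suc n)
  have "monom 1 (Suc n) = [:0, 1:] * (monom 1 n :: int poly)"
    by (simp add: monom_Suc)
  then show ?case
    by (simp only: emb_mult emb_var Suc power_Suc)
qed

lemma Nq_0 [simp]: "0 \<in> Nq" and Nq_1 [simp]: "1 \<in> Nq"
  by (auto simp: Nq_def coeff_1)

lemma Nq_add: "a \<in> Nq \<Longrightarrow> b \<in> Nq \<Longrightarrow> a + b \<in> Nq"
  by (auto simp: Nq_def)

lemma Nq_mult: "a \<in> Nq \<Longrightarrow> b \<in> Nq \<Longrightarrow> a * b \<in> Nq"
  by (auto simp: Nq_def coeff_mult intro!: sum_nonneg)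

lemma Nq_monom [simp]: "monom 1 n \<in> Nq"
  by (auto simp: Nq_def)

lemma Nq_sum: "(\<And>k. k \<in> A \<Longrightarrow> f k \<in> Nq) \<Longrightarrow> sum f A \<in> Nq"
  by (induction A rule: infinite_finite_induct) (auto intro: Nq_add)

text \<open>
  Splitting \<open>[a + b + 2]\<^sub>q\<close> as \<open>[a + 1]\<^sub>q + q\<^bsup>a + 1\<^esup> [b + 1]\<^sub>q\<close> is the q-Pascal rule, which
  builds Gaussian binomials from smaller ones without subtraction or division.
\<close>
lemma gaussian_binomial_Nq: "\<exists>p\<in>Nq. emb p = q_fact (a + b) / (q_fact a * q_fact b)"
proof (induction "a + b" arbitrary: a b)
  case 0
  then show ?case by (intro bexI[of _ 1]) (simp_all add: emb_1)
next
  case (Suc n)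
  show ?case
  proof (cases "a = 0 \<or> b = 0")
    case True
    then show ?thesis by (intro bexI[of _ 1]) (auto simp: emb_1)
  next
    case False
    then obtain a' b' where ab: "a = Suc a'" "b = Suc b'"
      by (meson not0_implies_Suc)
    obtain p1 where p1: "p1 \<in> Nq" "emb p1 = q_fact (a' + b) / (q_fact a' * q_fact b)"
      using Suc(1)[of a' b] Suc(2) ab by auto
    obtain p2 where p2: "p2 \<in> Nq" "emb p2 = q_fact (a + b') / (q_fact a * q_fact b')"
      using Suc(1)[of a b'] Suc(2) ab by auto
    have "emb (p1 + monom 1 a * p2) = q_fact (a + b) / (q_fact a * q_fact b)"
      using q_int_add[of a b]
      by (simp add: emb_add emb_mult emb_monom p1 p2 ab q_fact_Suc field_simps del: power_Suc)
    moreover have "p1 + monom 1 a * p2 \<in> Nq"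
      using p1 p2 by (intro Nq_add Nq_mult Nq_monom)
    ultimately show ?thesis by blast
  qed
qed


section \<open>Values of the q-binomial polynomials at q-integers\<close>

lemma q_binom_0 [simp]: "q_binom 0 = 1"
  by (simp add: q_binom_def binomial_eq_0)

text \<open>
  The power of \<open>q\<close> appears because \<open>k + 1\<close> choose \<open>2\<close> exceeds \<open>k\<close> choose \<open>2\<close> by \<open>k\<close>.
\<close>
lemma q_binom_Suc:
  "smult (q ^ k * q_int (Suc k)) (q_binom (Suc k)) = [:- q_int k, 1:] * q_binom k"
proof -
  have "Suc k choose 2 = k + (k choose 2)"
    by (simp add: numeral_2_eq_2)
  then show ?thesis
    by (simp add: q_binom_def q_fact_Suc power_add mult.commute)
qed

lemma degree_q_binom_le: "degree (q_binom k) \<le> k"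
proof -
  have "degree (\<Prod>m<k. [:- q_int m, 1:]) \<le> (\<Sum>m<k. degree [:- q_int m, 1:])"
    using degree_prod_sum_le[of "{..<k}" "\<lambda>m. [:- q_int m, 1:]"] by simp
  then show ?thesis
    by (simp add: q_binom_def)
qed

lemma poly_q_binom_less:
  assumes "n < k"
  shows "poly (q_binom k) (q_int n) = 0"
  using assms by (auto simp: q_binom_def poly_prod)

text \<open>
  The Gaussian binomial arises from evaluating the recurrence \<open>q_binom_Suc\<close>, where the
  factor \<open>[n + k + 1]\<^sub>q - [k]\<^sub>q = q\<^bsup>k\<^esup> [n + 1]\<^sub>q\<close> cancels the power of \<open>q\<close> in the denominator.
\<close>
lemma poly_q_binom_ge: "poly (q_binom k) (q_int (n + k)) = q_fact (n + k) / (q_fact n * q_fact k)"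
proof (induction k arbitrary: n)
  case 0
  then show ?case by simp
next
  case (Suc k)
  have "q ^ k * q_int (Suc k) * poly (q_binom (Suc k)) (q_int (n + Suc k))
          = (q_int (n + Suc k) - q_int k) * poly (q_binom k) (q_int (Suc n + k))"
    using arg_cong[OF q_binom_Suc[of k], of "\<lambda>P. poly P (q_int (n + Suc k))"]
    by (simp add: algebra_simps)
  also have "q_int (n + Suc k) - q_int k = q ^ k * q_int (Suc n)"
    using q_int_add[of k "Suc n"] by (simp add: add.commute)
  finally show ?case
    unfolding Suc.IH by (simp add: q_fact_Suc field_simps)
qed

lemma poly_q_binom_diag: "poly (q_binom k) (q_int k) = 1"
  using poly_q_binom_ge[of k 0] by simp

lemma q_binom_in_Rq_plus: "q_binom k \<in> Rq_plus"
  unfolding Rq_plus_def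
proof (intro CollectI allI)
  fix n
  show "poly (q_binom k) (q_int n) \<in> Zq"
  proof (cases "n < k")
    case True
    then show ?thesis
      using poly_q_binom_less rangeI[of emb 0] by (simp add: Zq_def)
  next
    case False
    then show ?thesis
      using poly_q_binom_ge[of k "n - k"] gaussian_binomial_Nq[of "n - k" k]
      by (auto simp: Zq_def intro: range_eqI[OF sym])
  qed
qed


section \<open>The q-binomial polynomials form a basis\<close>

lemma Zq_subalgebra_Rq_plus: "Zq_subalgebra Rq_plus"
  unfolding Zq_subalgebra_def Zq.subspace_def
  using rangeI[of emb 0] rangeI[of emb 1]
  by (auto simp: Rq_plus_def Zq_scale_def emb_1 Zq_def image_iff)
     (metis emb_add emb_mult)+

lemma inj_q_binom: "inj q_binom"
proof -
  have "q_binom m \<noteq> q_binom n" if "m < n" for m n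
    using poly_q_binom_less[OF that] poly_q_binom_diag[of m] by auto
  then show ?thesis
    by (metis injI linorder_neqE_nat)
qed

lemma independent_q_binom: "Zq.independent (range q_binom)"
  unfolding Zq.dependent_explicit
proof (rule notI, elim exE conjE bexE)
  fix t u v
  assume t: "finite t" "t \<subseteq> range q_binom" and sum: "(\<Sum>v\<in>t. Zq_scale (u v) v) = 0"
    and v: "v \<in> t" "u v \<noteq> 0"
  \<comment> \<open>At \<open>[k]\<^sub>q\<close> the terms of higher index vanish by triangularity, those of lower index because
    \<open>k\<close> is least.\<close>
  define k where "k = (LEAST k. q_binom k \<in> t \<and> u (q_binom k) \<noteq> 0)"
  have "\<exists>k. q_binom k \<in> t \<and> u (q_binom k) \<noteq> 0"
    using t v by blast
  then have k: "q_binom k \<in> t" "u (q_binom k) \<noteq> 0"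
    unfolding k_def by (metis (mono_tags, lifting) LeastI)+
  have "0 = (\<Sum>v\<in>t. emb (u v) * poly v (q_int k))"
    using arg_cong[OF sum, of "\<lambda>P. poly P (q_int k)"] by (simp add: poly_sum Zq_scale_def)
  also have "\<dots> = (\<Sum>v\<in>{q_binom k}. emb (u v) * poly v (q_int k))"
  proof (rule sum.mono_neutral_right)
    show "\<forall>v\<in>t - {q_binom k}. emb (u v) * poly v (q_int k) = 0"
    proof
      fix w
      assume w: "w \<in> t - {q_binom k}"
      then obtain m where m: "w = q_binom m" "m \<noteq> k"
        using t by blast
      show "emb (u w) * poly w (q_int k) = 0"
      proof (cases "m < k")
        case True
        then have "u w = 0"
          using not_less_Least[of m "\<lambda>k. q_binom k \<in> t \<and> u (q_binom k) \<noteq> 0"] w m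
          unfolding k_def by auto
        then show ?thesis by simp
      next
        case False
        then show ?thesis
          using m poly_q_binom_less[of k m] by simp
      qed
    qed
  qed (use t k in auto)
  also have "\<dots> = emb (u (q_binom k))"
    by (simp add: poly_q_binom_diag)
  finally show False
    using k by simp
qed

lemma span_q_binom_subset: "Zq.span (range q_binom) \<subseteq> Rq_plus"
  using Zq_subalgebra_Rq_plus q_binom_in_Rq_plus
  by (intro Zq.span_minimal) (auto simp: Zq_subalgebra_def)

text \<open>
  Since \<open>B\<^sub>n\<close> is \<open>0\<close> at the earlier nodes and \<open>1\<close> at \<open>[n]\<^sub>q\<close>, adding the current error times \<open>B\<^sub>n\<close>
  corrects the value at \<open>[n]\<^sub>q\<close> and disturbs none of the earlier ones. The error is an integer
  polynomial in \<open>q\<close>, being a value of a member of the algebra.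
  The degree bound makes the interpolant unique once there are \<open>N + 1\<close> nodes.
\<close>
lemma newton_interpolation:
  assumes "P \<in> Rq_plus" and "n \<le> Suc N"
  shows "\<exists>Q \<in> Zq.span (range q_binom).
           degree Q \<le> N \<and> (\<forall>m<n. poly Q (q_int m) = poly P (q_int m))"
  using assms(2)
proof (induction n)
  case 0
  then show ?case by (intro bexI[of _ 0]) (simp_all add: Zq.span_zero)
next
  case (Suc n)
  then obtain Q where Q: "Q \<in> Zq.span (range q_binom)" "degree Q \<le> N"
    "\<And>m. m < n \<Longrightarrow> poly Q (q_int m) = poly P (q_int m)" by auto
  have "P - Q \<in> Rq_plus"
    using Q(1) assms(1) span_q_binom_subset Zq_subalgebra_Rq_plus
    unfolding Zq_subalgebra_def by (meson Zq.subspace_diff subsetD)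
  then obtain v where v: "emb v = poly P (q_int n) - poly Q (q_int n)"
    by (auto simp: Rq_plus_def Zq_def image_iff) metis
  show ?case
  proof (intro bexI[of _ "Q + Zq_scale v (q_binom n)"] conjI allI impI)
    show "Q + Zq_scale v (q_binom n) \<in> Zq.span (range q_binom)"
      by (intro Zq.span_add Q(1) Zq.span_scale Zq.span_base rangeI)
    have "degree (q_binom n) \<le> N"
      using degree_q_binom_le[of n] Suc.prems by simp
    then show "degree (Q + Zq_scale v (q_binom n)) \<le> N"
      unfolding Zq_scale_def using Q(2) degree_smult_le order_trans
      by (intro degree_add_le) blast+
    show "poly (Q + Zq_scale v (q_binom n)) (q_int m) = poly P (q_int m)" if "m < Suc n" for m
      using that Q(3) by (cases "m = n")
        (simp_all add: Zq_scale_def poly_q_binom_diag poly_q_binom_less v)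
  qed
qed

lemma span_q_binom: "Zq.span (range q_binom) = Rq_plus"
proof
  show "Zq.span (range q_binom) \<subseteq> Rq_plus"
    by (rule span_q_binom_subset)
  show "Rq_plus \<subseteq> Zq.span (range q_binom)"
  proof
    fix P
    assume "P \<in> Rq_plus"
    then obtain Q where Q: "Q \<in> Zq.span (range q_binom)" "degree Q \<le> degree P"
      "\<And>m. m < Suc (degree P) \<Longrightarrow> poly Q (q_int m) = poly P (q_int m)"
      using newton_interpolation[of P "Suc (degree P)" "degree P"] by auto
    have "card (q_int ` {..<Suc (degree P)}) = Suc (degree P)"
      using inj_q_int by (simp add: card_image inj_on_def)
    then have "Q = P"
      using Q(2,3) by (intro poly_eqI_degree[of "q_int ` {..<Suc (degree P)}"]) auto
    then show "P \<in> Zq.span (range q_binom)"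
      using Q(1) by simp
  qed
qed


section \<open>The structure constants\<close>

text \<open>
  Extending the coefficients by zero outside the range of summation lets the recurrence below
  hold for all indices. The condition is explicit because truncated subtraction would not
  produce these zeros.
\<close>
definition q_binom_coeff :: "nat \<Rightarrow> nat \<Rightarrow> nat \<Rightarrow> ratfun" where
  "q_binom_coeff i j k =
     (if max i j \<le> k \<and> k \<le> i + j
      then q ^ ((k - i) * (k - j)) * q_fact k
             / (q_fact (k - i) * q_fact (k - j) * q_fact (i + j - k))
      else 0)"

text \<open>
  In terms of the differences \<open>a = k - j\<close>, \<open>b = k - i\<close> and \<open>d = i + j - k\<close> the coefficient is a
  power of \<open>q\<close> times a q-trinomial coefficient.
\<close>
lemma q_binom_coeff_eq:
  "q_binom_coeff (a + d) (b + d) (a + b + d) =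
     q ^ (b * a) * q_fact (a + b + d) / (q_fact b * q_fact a * q_fact d)"
  by (simp add: q_binom_coeff_def algebra_simps)

lemma q_binom_coeff_Nq: "\<exists>p\<in>Nq. emb p = q_binom_coeff i j k"
proof (cases "max i j \<le> k \<and> k \<le> i + j")
  case False
  then show ?thesis by (intro bexI[of _ 0]) (auto simp: q_binom_coeff_def)
next
  case True
  define a b d where "a = k - j" and "b = k - i" and "d = i + j - k"
  then have param: "i = a + d" "j = b + d" "k = a + b + d"
    using True by auto
  obtain p1 where p1: "p1 \<in> Nq" "emb p1 = q_fact (a + b) / (q_fact a * q_fact b)"
    using gaussian_binomial_Nq by blast
  obtain p2 where p2: "p2 \<in> Nq" "emb p2 = q_fact (a + b + d) / (q_fact (a + b) * q_fact d)"
    using gaussian_binomial_Nq by blast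
  have "emb (monom 1 (b * a) * (p1 * p2)) = q_binom_coeff i j k"
    unfolding param q_binom_coeff_eq by (simp add: emb_mult emb_monom p1 p2 field_simps)
  then show ?thesis
    using p1 p2 by (intro bexI[of _ "monom 1 (b * a) * (p1 * p2)"] Nq_mult) auto
qed

text \<open>
  This compares the coefficients of \<open>B\<^bsub>k + 1\<^esub>\<close> in \<open>(x - [i]\<^sub>q) B\<^sub>i B\<^sub>j\<close>. In the interior of the range,
  with \<open>k = i + b = j + a\<close> and \<open>i + j = k + d + 1\<close>, cancelling common factors leaves
  \<open>[i + 1]\<^sub>q = [a + 1]\<^sub>q + q\<^bsup>a + 1\<^esup> [d + 1]\<^sub>q\<close>, which holds as \<open>i = a + d + 1\<close>.
\<close>
lemma q_binom_coeff_rec: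
  "q ^ i * q_int (Suc i) * q_binom_coeff (Suc i) j (Suc k) =
     q_binom_coeff i j (Suc k) * (q_int (Suc k) - q_int i)
     + q_binom_coeff i j k * (q ^ k * q_int (Suc k))"
proof -
  \<comment> \<open>In the first case all terms vanish. For \<open>k = i + j\<close> and for \<open>k + 1 = j\<close> one of the two
    coefficients on the right lies outside its range.\<close>
  consider "k < i \<or> Suc k < j \<or> i + j < k" | "k = i + j" "k \<ge> i" "k \<ge> j"
    | "k \<ge> i" "Suc k = j" "k < i + j" | "k \<ge> i" "k \<ge> j" "k < i + j"
    by linarith
  then show ?thesis
  proof cases
    case 1
    then show ?thesis
      by (cases "Suc k = i") (auto simp: q_binom_coeff_def)
  next
    case 2
    have "Suc k - Suc i = j" "Suc k - j = Suc i" "Suc i + j - Suc k = 0" "k - i = j" "k - j = i"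
      using 2 by auto
    moreover have "q_binom_coeff i j (Suc k) = 0"
      using 2 by (simp add: q_binom_coeff_def)
    ultimately show ?thesis
      using 2 by (simp add: q_binom_coeff_def q_fact_Suc field_simps power_add)
  next
    case 3
    then obtain b where k: "k = i + b" "j = Suc (i + b)"
      by (metis le_Suc_ex)
    have "q_int (Suc k) - q_int i = q ^ i * q_int (Suc b)"
      using q_int_add[of i "Suc b"] k by simp
    moreover have "q_binom_coeff i j k = 0"
      using 3 by (simp add: q_binom_coeff_def)
    ultimately show ?thesis
      using k by (simp add: q_binom_coeff_def q_fact_Suc field_simps)
  next
    case 4
    then obtain b where b: "k = i + b"
      by (metis le_Suc_ex)
    obtain a where a: "k = j + a"
      using 4 by (metis le_Suc_ex)
    obtain d where d: "i + j = Suc (k + d)"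
      using 4 by (metis less_imp_Suc_add)
    have i: "i = Suc (a + d)" and j: "j = Suc (b + d)" and k: "k = Suc (a + b + d)"
      using a b d by auto
    have e1: "q_int (Suc k) - q_int i = q ^ i * q_int (Suc b)"
      using q_int_add[of i "Suc b"] b by simp
    have e2: "q_binom_coeff (Suc i) j (Suc k) =
        q ^ (b * Suc a) * q_fact (Suc k) / (q_fact b * q_fact (Suc a) * q_fact (Suc d))"
      using q_binom_coeff_eq[of "Suc a" "Suc d" b] by (simp add: i j k add_ac)
    have e3: "q_binom_coeff i j (Suc k) =
        q ^ (Suc b * Suc a) * q_fact (Suc k) / (q_fact (Suc b) * q_fact (Suc a) * q_fact d)"
      using q_binom_coeff_eq[of "Suc a" d "Suc b"] by (simp add: i j k add_ac)
    have e4: "q_binom_coeff i j k =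
        q ^ (b * a) * q_fact k / (q_fact b * q_fact a * q_fact (Suc d))"
      using q_binom_coeff_eq[of a "Suc d" b] by (simp add: i j k add_ac)
    have e5: "q_int (Suc i) = q_int (Suc a) + q ^ Suc a * q_int (Suc d)"
      using q_int_add[of "Suc a" "Suc d"] by (simp add: i)
    show ?thesis
      unfolding e1 e2 e3 e4 e5 unfolding i k
      by (simp add: q_fact_Suc divide_simps power_add) (simp add: algebra_simps power_add)
  qed
qed

lemma smult_sum_right: "smult c (\<Sum>x\<in>A. f x) = (\<Sum>x\<in>A. smult c (f x))"
  by (induction A rule: infinite_finite_induct) (simp_all add: smult_add_right)

lemma q_binom_mult: "q_binom i * q_binom j = (\<Sum>k\<le>i + j. smult (q_binom_coeff i j k) (q_binom k))"
proof (induction i)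
  case 0
  have "(\<Sum>k\<le>j. smult (q_binom_coeff 0 j k) (q_binom k)) =
          (\<Sum>k\<in>{j}. smult (q_binom_coeff 0 j k) (q_binom k))"
    by (rule sum.mono_neutral_right) (auto simp: q_binom_coeff_def)
  then show ?case
    by (simp add: q_binom_coeff_def)
next
  case (Suc i)
  let ?c = "q_binom_coeff i j"
  let ?s = "q ^ i * q_int (Suc i)"
  have shift: "[:- q_int i, 1:] * q_binom k =
      smult (q_int k - q_int i) (q_binom k) + smult (q ^ k * q_int (Suc k)) (q_binom (Suc k))" for k
    unfolding q_binom_Suc by (simp add: algebra_simps smult_diff_left)
  have c0: "?c 0 * (q_int 0 - q_int i) = 0" "q_binom_coeff (Suc i) j 0 = 0"
    by (auto simp: q_binom_coeff_def)
  have cS: "?c (Suc (i + j)) = 0"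
    by (simp add: q_binom_coeff_def)
  have "smult ?s (q_binom (Suc i) * q_binom j) = [:- q_int i, 1:] * (q_binom i * q_binom j)"
    unfolding mult.assoc[symmetric] q_binom_Suc[symmetric] by simp
  also have "\<dots> = (\<Sum>k\<le>i + j. smult (?c k) ([:- q_int i, 1:] * q_binom k))"
    unfolding Suc sum_distrib_left by (simp only: mult_smult_right)
  also have "\<dots> = (\<Sum>k\<le>i + j. smult (?c k * (q_int k - q_int i)) (q_binom k))
      + (\<Sum>k\<le>i + j. smult (?c k * (q ^ k * q_int (Suc k))) (q_binom (Suc k)))"
    by (simp only: shift smult_add_right smult_smult sum.distrib)
  also have "(\<Sum>k\<le>i + j. smult (?c k * (q_int k - q_int i)) (q_binom k)) =
      (\<Sum>k\<le>Suc (i + j). smult (?c k * (q_int k - q_int i)) (q_binom k))"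
    by (simp add: cS)
  also have "\<dots> = (\<Sum>k\<le>i + j. smult (?c (Suc k) * (q_int (Suc k) - q_int i)) (q_binom (Suc k)))"
    unfolding sum.atMost_Suc_shift c0 by simp
  also have "\<dots> + (\<Sum>k\<le>i + j. smult (?c k * (q ^ k * q_int (Suc k))) (q_binom (Suc k))) =
      (\<Sum>k\<le>i + j. smult (?s * q_binom_coeff (Suc i) j (Suc k)) (q_binom (Suc k)))"
    by (simp only: q_binom_coeff_rec smult_add_left sum.distrib)
  also have "\<dots> = (\<Sum>k\<le>Suc (i + j). smult (?s * q_binom_coeff (Suc i) j k) (q_binom k))"
    unfolding sum.atMost_Suc_shift c0 by simp
  also have "\<dots> = smult ?s (\<Sum>k\<le>Suc i + j. smult (q_binom_coeff (Suc i) j k) (q_binom k))"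
    by (simp only: smult_sum_right smult_smult add_Suc)
  finally show ?case
    by (rule smult_cancel[rotated]) simp
qed

lemma structure_constant_Nq:
  "structure_constant (range q_binom) (q_binom a) (q_binom b) (q_binom c) \<in> Nq"
proof -
  obtain p where p: "\<And>k. p k \<in> Nq" "\<And>k. emb (p k) = q_binom_coeff a b k"
    using q_binom_coeff_Nq by metis
  have base: "q_binom k \<in> Zq.span (range q_binom)" for k
    by (intro Zq.span_base rangeI)
  have "q_binom a * q_binom b = (\<Sum>k\<le>a + b. Zq_scale (p k) (q_binom k))"
    by (simp add: q_binom_mult Zq_scale_def p)
  then have "structure_constant (range q_binom) (q_binom a) (q_binom b) (q_binom c) =
      (\<Sum>k\<le>a + b. p k * (if q_binom c = q_binom k then 1 else 0))"
    unfolding structure_constant_def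
    by (simp add: Zq.representation_sum Zq.representation_scale Zq.representation_basis
        independent_q_binom base Zq.span_scale eq_commute)
  also have "\<dots> \<in> Nq"
    using p(1) by (intro Nq_sum Nq_mult) auto
  finally show ?thesis .
qed

theorem theorem3p2:
  fixes i j :: nat
  shows "q_binom i * q_binom j =
           (\<Sum>k = max i j..i + j.
              smult (q ^ ((k - i) * (k - j)) * q_fact k
                      / (q_fact (k - i) * q_fact (k - j) * q_fact (i + j - k)))
                (q_binom k))
       \<and> Zq_subalgebra Rq_plus \<and> inj q_binom \<and> Zq_basis (range q_binom) Rq_plus
       \<and> (\<forall>a b c. structure_constant (range q_binom) (q_binom a) (q_binom b) (q_binom c) \<in> Nq)"
proof (intro conjI allI)
  have "(\<Sum>k\<le>i + j. smult (q_binom_coeff i j k) (q_binom k)) =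
      (\<Sum>k = max i j..i + j. smult (q_binom_coeff i j k) (q_binom k))"
    by (rule sum.mono_neutral_right) (auto simp: q_binom_coeff_def)
  then show "q_binom i * q_binom j =
           (\<Sum>k = max i j..i + j.
              smult (q ^ ((k - i) * (k - j)) * q_fact k
                      / (q_fact (k - i) * q_fact (k - j) * q_fact (i + j - k)))
                (q_binom k))"
    unfolding q_binom_mult by (auto simp: q_binom_coeff_def intro!: sum.cong)
  show "Zq_basis (range q_binom) Rq_plus"
    by (simp add: Zq_basis_def independent_q_binom span_q_binom)
qed (rule Zq_subalgebra_Rq_plus inj_q_binom structure_constant_Nq)+

end
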